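(* The Bannai--Ito algebra (with central structure elements $\omega_1,\omega_2,\omega_3$) is isomorphic, as a unital associative $\mathbb{C}$-algebra, to the universal degenerate double affine Hecke algebra of type $(C_1^{\vee},C_1)$.
   Context: Write $\{A,B\}=AB+BA$. The Bannai--Ito algebra is the unital associative $\mathbb{C}$-algebra with generators $K_1,K_2,K_3$ and $\omega_1,\omega_2,\omega_3$, with relations stating that $\omega_1,\omega_2,\omega_3$ are central and that $$\{K_1,K_2\}=K_3+\omega_3,\qquad \{K_2,K_3\}=K_1+\omega_1,\qquad \{K_3,K_1\}=K_2+\omega_2.$$ The degenerate double affine Hecke algebra of type $(C_1^\vee,C_1)$ with complex parameters $t_0,t_1,u_0,u_1$ has generators $T_0,T_1,U_0,U_1$ and relations $T_0^2=t_0^2$, $T_1^2=t_1^2$, $U_0^2=u_0^2$, $U_1^2=u_1^2$, $T_0+T_1+U_0+U_1=-\tfrac12$. Its universal version is obtained by letting the values of the squares be central elements instead of scalars: it is the unital associative $\mathbb{C}$-algebra with generators $T_0,T_1,U_0,U_1$ and relations stating that $T_0^2,\ T_1^2,\ U_0^2,\ U_1^2$ are all central and that $$T_0+T_1+U_0+U_1=-\tfrac12 .$$ *)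

theory Defs
  imports Complex_Main "HOL-Library.Poly_Mapping" "HOL-Algebra.QuotRing" "HOL-Algebra.Module"
begin

section \<open>Free algebras over the complex numbers\<close>

text \<open>A wrapper around lists, so that the free monoid can be used (additively) as the index
  monoid of \<open>poly_mapping\<close>; multiplication of \<open>'g word \<Rightarrow>\<^sub>0 complex\<close> is then the
  convolution product, i.e. that of noncommutative polynomials.\<close>

datatype 'g word = Word (letters: "'g list")

instantiation word :: (type) monoid_add
begin

definition zero_word :: "'a word" where
  "0 = Word []"

definition plus_word :: "'a word \<Rightarrow> 'a word \<Rightarrow> 'a word" where
  "u + v = Word (letters u @ letters v)"

instance
  by standard (simp_all add: zero_word_def plus_word_def)

end

type_synonym 'g free = "'g word \<Rightarrow>\<^sub>0 complex"

definition gen :: "'g \<Rightarrow> 'g free" where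
  "gen g = Poly_Mapping.single (Word [g]) 1"

definition scalar :: "complex \<Rightarrow> 'g free" where
  "scalar c = Poly_Mapping.single 0 c"

definition free_algebra :: "(complex, 'g free) module" where
  "free_algebra =
    \<lparr>carrier = UNIV, monoid.mult = (*), one = 1, zero = 0, add = (+),
     smult = (\<lambda>c. Poly_Mapping.map ((*) c))\<rparr>"

lemma ring_free_algebra: "ring free_algebra"
proof (rule ringI)
  show "abelian_group free_algebra"
  proof (rule abelian_groupI)
    fix x :: "'g free"
    show "\<exists>y\<in>carrier free_algebra. y \<oplus>\<^bsub>free_algebra\<^esub> x = \<zero>\<^bsub>free_algebra\<^esub>"
      by (intro bexI[of _ "- x"]) (simp_all add: free_algebra_def)
  qed (simp_all add: free_algebra_def algebra_simps)
  show "Group.monoid free_algebra"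
    by (rule monoidI) (simp_all add: free_algebra_def mult.assoc)
qed (simp_all add: free_algebra_def distrib_left distrib_right)


section \<open>Quotients and presentations\<close>

text \<open>The HOL-Algebra quotient ring, with scalars acting on representatives of cosets.\<close>

definition quotient_algebra :: "('k, 'a) module \<Rightarrow> 'a set \<Rightarrow> ('k, 'a set) module" where
  "quotient_algebra A I =
    ring.extend (A Quot I)
      (module.fields (\<lambda>c X. \<Union>x\<in>X. I +>\<^bsub>A\<^esub> (c \<odot>\<^bsub>A\<^esub> x)))"

definition presented_algebra :: "'g free set \<Rightarrow> (complex, 'g free set) module" where
  "presented_algebra R = quotient_algebra free_algebra (Idl\<^bsub>free_algebra\<^esub> R)"

text \<open>The relators (left-hand side minus right-hand side) that make \<open>z\<close> central.\<close>

definition central_relators :: "'g free \<Rightarrow> 'g free set" where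
  "central_relators z = {z * x - x * z | x. True}"

definition anticomm :: "'a::ring \<Rightarrow> 'a \<Rightarrow> 'a" where
  "anticomm a b = a * b + b * a"

lemma ideal_presented: "ideal (Idl\<^bsub>free_algebra\<^esub> R) (free_algebra :: (complex, 'g free) module)"
  by (rule ring.genideal_ideal[OF ring_free_algebra]) (simp add: free_algebra_def)

lemma ring_presented_algebra: "ring (presented_algebra (R :: 'g free set))"
proof -
  let ?F = "free_algebra :: (complex, 'g free) module" and ?I = "Idl\<^bsub>free_algebra\<^esub> R"
  interpret Q: ring "?F Quot ?I"
    by (rule ideal.quotient_is_ring[OF ideal_presented])
  have sel: "carrier (presented_algebra R) = carrier (?F Quot ?I)"
    "monoid.mult (presented_algebra R) = monoid.mult (?F Quot ?I)"
    "one (presented_algebra R) = one (?F Quot ?I)"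
    "zero (presented_algebra R) = zero (?F Quot ?I)"
    "add (presented_algebra R) = add (?F Quot ?I)"
    by (simp_all add: presented_algebra_def quotient_algebra_def ring.defs module.defs)
  show ?thesis
  proof (rule ringI)
    show "abelian_group (presented_algebra R)"
    proof (rule abelian_groupI, unfold sel)
      fix x assume "x \<in> carrier (?F Quot ?I)"
      then show "\<exists>y\<in>carrier (?F Quot ?I). y \<oplus>\<^bsub>?F Quot ?I\<^esub> x = \<zero>\<^bsub>?F Quot ?I\<^esub>"
        using Q.l_neg Q.a_inv_closed by blast
    qed (fact Q.a_closed Q.zero_closed Q.a_assoc Q.a_comm Q.l_zero)+
    show "Group.monoid (presented_algebra R)"
      by (rule monoidI, unfold sel)
        (fact Q.m_closed Q.one_closed Q.m_assoc Q.l_one Q.r_one)+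
  qed (unfold sel, (fact Q.l_distr Q.r_distr)+)
qed

lemma smult_presented_coset:
  fixes x :: "'g free" and R :: "'g free set"
  defines "I \<equiv> Idl\<^bsub>free_algebra\<^esub> R"
  shows "c \<odot>\<^bsub>presented_algebra R\<^esub> (I +>\<^bsub>free_algebra\<^esub> x)
    = I +>\<^bsub>free_algebra\<^esub> (scalar c * x)"
proof -
  interpret ideal I "free_algebra :: (complex, 'g free) module"
    unfolding I_def by (rule ideal_presented)
  have sm: "c \<odot>\<^bsub>free_algebra\<^esub> y = scalar c * y" for y :: "'g free"
    by (simp add: free_algebra_def scalar_def mult_map_scale_conv_mult)
  have cong: "I +>\<^bsub>free_algebra\<^esub> (scalar c * y) = I +>\<^bsub>free_algebra\<^esub> (scalar c * x)"
    if y: "y \<in> I +>\<^bsub>free_algebra\<^esub> x" for y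
  proof -
    obtain h where h: "h \<in> I" "y = h + x"
      using y by (auto simp: a_r_coset_def r_coset_def free_algebra_def)
    have "scalar c * h \<in> I"
      using I_l_closed[OF h(1), of "scalar c"] by (simp add: free_algebra_def)
    then have "scalar c * y \<in> I +>\<^bsub>free_algebra\<^esub> (scalar c * x)"
      using h by (auto simp: a_r_coset_def r_coset_def free_algebra_def distrib_left)
    then show ?thesis
      using a_repr_independence'[of "scalar c * y" "scalar c * x"] by (simp add: free_algebra_def)
  qed
  have "x \<in> I +>\<^bsub>free_algebra\<^esub> x"
    by (rule a_rcos_self) (simp add: free_algebra_def)
  then have "(\<Union>y\<in>I +>\<^bsub>free_algebra\<^esub> x. I +>\<^bsub>free_algebra\<^esub> (scalar c * y))
      = I +>\<^bsub>free_algebra\<^esub> (scalar c * x)"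
    using cong by blast
  then show ?thesis
    by (simp add: presented_algebra_def quotient_algebra_def ring.defs module.defs sm I_def)
qed


section \<open>The two algebras\<close>

datatype bi_gen = K1 | K2 | K3 | \<omega>1 | \<omega>2 | \<omega>3

definition bi_relators :: "bi_gen free set" where
  "bi_relators =
    central_relators (gen \<omega>1) \<union> central_relators (gen \<omega>2) \<union> central_relators (gen \<omega>3) \<union>
    {anticomm (gen K1) (gen K2) - (gen K3 + gen \<omega>3),
     anticomm (gen K2) (gen K3) - (gen K1 + gen \<omega>1),
     anticomm (gen K3) (gen K1) - (gen K2 + gen \<omega>2)}"

definition bannai_ito_algebra :: "(complex, bi_gen free set) module" where
  "bannai_ito_algebra = presented_algebra bi_relators"

datatype ddaha_gen = T0 | T1 | U0 | U1

definition ddaha_relators :: "ddaha_gen free set" where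
  "ddaha_relators =
    central_relators (gen T0 ^ 2) \<union> central_relators (gen T1 ^ 2) \<union>
    central_relators (gen U0 ^ 2) \<union> central_relators (gen U1 ^ 2) \<union>
    {gen T0 + gen T1 + gen U0 + gen U1 - scalar (- 1 / 2)}"

definition universal_ddaha :: "(complex, ddaha_gen free set) module" where
  "universal_ddaha = presented_algebra ddaha_relators"

end

theory Submission
  imports Defs
begin

text \<open>Write \<open>a, b, c, d\<close> for \<open>T0, T1, U0, U1\<close>. Since \<open>d = - (a + b + c + 1/2)\<close>, comparing
  \<open>d\<^sup>2\<close> with the square of the right-hand side expresses
  \<open>{a, b} + {b, c} + {c, a}\<close> through linear terms and central squares. Hence \<open>-2\<close> times the pairwise
  sums of \<open>a, b, c\<close>, suitably shifted, satisfy the Bannai--Ito relations, with each \<open>\<omega>\<close> equal to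
  four times a signed sum of the squares. Inverting this linear change of variables gives
  \<open>d = (K1 + K2 + K3 - 1/2) / 4\<close>, while \<open>a, b, c\<close> arise from \<open>d\<close> by changing the signs of two of the
  \<open>K\<close>'s, which is a symmetry of the Bannai--Ito relations. The square of \<open>4 d\<close> differs from the
  Casimir element \<open>K1\<^sup>2 + K2\<^sup>2 + K3\<^sup>2\<close> only by central terms, so all four squares are
  central.\<close>

section \<open>Homomorphisms of free algebras\<close>

lemma scalar_simps:
  "scalar 0 = 0" "scalar 1 = 1" "scalar (c + d) = scalar c + scalar d"
  "scalar (c * d) = scalar c * scalar d" "scalar (- c) = - scalar c"
  by (simp_all add: scalar_def single_add mult_single single_uminus)

lemma single_word_Cons:
  "Poly_Mapping.single (Word (g # gs)) c = gen g * Poly_Mapping.single (Word gs) c"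
  by (simp add: gen_def mult_single plus_word_def)

lemma poly_mapping_add_induct [case_names zero single add]:
  assumes "P 0" "\<And>w c. P (Poly_Mapping.single w c)" "\<And>x y. P x \<Longrightarrow> P y \<Longrightarrow> P (x + y)"
  shows "P (x :: 'a \<Rightarrow>\<^sub>0 'b::comm_monoid_add)"
proof (induction x rule: update_induct)
  case const
  show ?case using assms(1) by simp
next
  case (update x w c)
  \<comment> \<open>The new key \<open>w\<close> lies outside the support of \<open>x\<close>, so
    assigning a value there amounts to adding a monomial.\<close>
  have "Poly_Mapping.update w c x = x + Poly_Mapping.single w c"
    using update(1) by (auto intro!: poly_mapping_eqI simp: lookup_update lookup_add lookup_single
        when_def in_keys_iff)
  then show ?case
    using assms(2,3) update by metis
qed

text \<open>A word is a product of generators, so scalars and generators generate the whole algebra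
  under sums and products. This reduces later claims to generators.\<close>

lemma free_induct [case_names scalar gen add mult]:
  assumes scal: "\<And>c. P (scalar c)" and gen: "\<And>g. P (gen g)"
    and add: "\<And>x y. P x \<Longrightarrow> P y \<Longrightarrow> P (x + y)" and mult: "\<And>x y. P x \<Longrightarrow> P y \<Longrightarrow> P (x * y)"
  shows "P (x :: 'g free)"
proof (induction x rule: poly_mapping_add_induct)
  case zero
  show ?case using scal[of 0] by (simp add: scalar_simps)
next
  case (single w c)
  have "P (Poly_Mapping.single (Word gs) c)" for gs
    by (induction gs)
      (use scal[of c] in \<open>simp_all add: single_word_Cons gen mult scalar_def zero_word_def\<close>)
  then show ?case by (metis word.collapse)
qed (rule add)

text \<open>The homomorphism that the universal property of the free algebra attaches to an
  assignment \<open>f\<close> of the generators.\<close>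

definition subst :: "('g \<Rightarrow> 'h free) \<Rightarrow> 'g free \<Rightarrow> 'h free" where
  "subst f x =
    (\<Sum>w\<in>Poly_Mapping.keys x. scalar (Poly_Mapping.lookup x w) * prod_list (map f (letters w)))"

lemma scalar_commute: "x * scalar c = scalar c * x"
proof (induction x rule: free_induct)
  case (scalar d)
  show ?case by (metis mult.commute scalar_simps(4))
next
  case (gen g)
  show ?case by (simp add: gen_def scalar_def mult_single)
next
  case (add x y)
  then show ?case by (simp add: algebra_simps)
next
  case (mult x y)
  then show ?case by (metis mult.assoc)
qed

lemma subst_add: "subst f (x + y) = subst f x + subst f y"
  unfolding subst_def
  by (rule setsum_keys_plus_distrib) (simp_all add: scalar_simps algebra_simps)

lemma subst_single:
  "subst f (Poly_Mapping.single w c) = scalar c * prod_list (map f (letters w))"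
  by (cases "c = 0") (simp_all add: subst_def scalar_simps)

lemma subst_scalar: "subst f (scalar c) = scalar c"
  by (subst scalar_def) (simp add: subst_single zero_word_def)

lemma subst_gen: "subst f (gen g) = f g"
  by (simp add: gen_def subst_single scalar_simps)

text \<open>Both sides are additive in each argument, so monomials suffice; there concatenation of
  words becomes the product, and coefficients move past word images by
  \<open>scalar_commute\<close>.\<close>

lemma subst_mult: "subst f (x * y) = subst f x * subst f y"
proof (induction x rule: poly_mapping_add_induct)
  case (single w c)
  show ?case
  proof (induction y rule: poly_mapping_add_induct)
    case (single v d)
    show ?case
      by (simp add: mult_single subst_single plus_word_def scalar_simps mult.assoc)
        (metis mult.assoc scalar_commute)
  qed (simp_all add: subst_add distrib_left, simp add: subst_def)
qed (simp_all add: subst_add distrib_right, simp_all add: subst_def)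

lemma subst_zero: "subst f 0 = 0"
  by (simp add: subst_def)

lemma subst_one: "subst f 1 = 1"
  using subst_scalar[of f 1] by (simp add: scalar_simps)

lemma subst_uminus: "subst f (- x) = - subst f x"
  using subst_add[of f x "- x"] by (simp add: subst_zero minus_unique)

lemma subst_diff: "subst f (x - y) = subst f x - subst f y"
  using subst_add[of f x "- y"] by (simp add: subst_uminus)

lemmas subst_simps = subst_zero subst_one subst_add subst_mult subst_uminus subst_diff
  subst_scalar subst_gen


section \<open>Presented algebras\<close>

abbreviation relator_ideal :: "'g free set \<Rightarrow> 'g free set" where
  "relator_ideal R \<equiv> Idl\<^bsub>free_algebra\<^esub> R"

abbreviation coset :: "'g free set \<Rightarrow> 'g free \<Rightarrow> 'g free set" where
  "coset R x \<equiv> relator_ideal R +>\<^bsub>free_algebra\<^esub> x"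

lemma free_algebra_simps:
  "carrier free_algebra = UNIV" "x \<otimes>\<^bsub>free_algebra\<^esub> y = x * y"
  "\<one>\<^bsub>free_algebra\<^esub> = 1" "\<zero>\<^bsub>free_algebra\<^esub> = 0"
  "x \<oplus>\<^bsub>free_algebra\<^esub> y = x + y"
  by (simp_all add: free_algebra_def)

lemma relator_ideal_incl: "x \<in> R \<Longrightarrow> x \<in> relator_ideal R"
  using ring.genideal_self[OF ring_free_algebra, of R] by (auto simp: free_algebra_simps)

lemma relator_ideal_zero: "0 \<in> relator_ideal R"
  using ideal_presented[of R, THEN ideal.axioms(1), THEN additive_subgroup.zero_closed]
  by (simp add: free_algebra_simps)

lemma relator_ideal_add:
  "x \<in> relator_ideal R \<Longrightarrow> y \<in> relator_ideal R \<Longrightarrow> x + y \<in> relator_ideal R"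
  using ideal_presented[of R, THEN ideal.axioms(1), THEN additive_subgroup.a_closed]
  by (simp add: free_algebra_simps)

lemma relator_ideal_mult_left: "x \<in> relator_ideal R \<Longrightarrow> y * x \<in> relator_ideal R"
  using ideal.I_l_closed[OF ideal_presented, of x R y] by (simp add: free_algebra_simps)

lemma relator_ideal_mult_right: "x \<in> relator_ideal R \<Longrightarrow> x * y \<in> relator_ideal R"
  using ideal.I_r_closed[OF ideal_presented, of x R y] by (simp add: free_algebra_simps)

lemma relator_ideal_uminus: "x \<in> relator_ideal R \<Longrightarrow> - x \<in> relator_ideal R"
  using relator_ideal_mult_left[of x R "- 1"] by simp

lemma relator_ideal_diff:
  "x \<in> relator_ideal R \<Longrightarrow> y \<in> relator_ideal R \<Longrightarrow> x - y \<in> relator_ideal R"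
  using relator_ideal_add[of x R "- y"] by (simp add: relator_ideal_uminus)

lemmas relator_ideal_intros = relator_ideal_zero relator_ideal_add relator_ideal_uminus
  relator_ideal_diff relator_ideal_mult_left relator_ideal_mult_right

lemma mem_coset_iff: "y \<in> coset R x \<longleftrightarrow> y - x \<in> relator_ideal R"
  by (force simp: a_r_coset_def r_coset_def free_algebra_simps)

lemma coset_eq_iff: "coset R x = coset R y \<longleftrightarrow> x - y \<in> relator_ideal R"
proof
  assume "coset R x = coset R y"
  moreover have "x \<in> coset R x" by (simp add: mem_coset_iff relator_ideal_zero)
  ultimately show "x - y \<in> relator_ideal R" by (simp add: mem_coset_iff)
next
  assume xy: "x - y \<in> relator_ideal R"
  have "z - x \<in> relator_ideal R \<longleftrightarrow> z - y \<in> relator_ideal R" for z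
    using relator_ideal_add[OF _ xy, of "z - x"] relator_ideal_diff[OF _ xy, of "z - y"] by auto
  then show "coset R x = coset R y"
    by (auto simp: mem_coset_iff)
qed

lemma presented_algebra_simps:
  "carrier (presented_algebra R) = range (coset R)"
  "coset R x \<otimes>\<^bsub>presented_algebra R\<^esub> coset R y = coset R (x * y)"
  "coset R x \<oplus>\<^bsub>presented_algebra R\<^esub> coset R y = coset R (x + y)"
  "\<one>\<^bsub>presented_algebra R\<^esub> = coset R 1"
proof -
  let ?F = "free_algebra :: (complex, 'a free) module"
  interpret ideal "relator_ideal R" ?F by (rule ideal_presented)
  have sel: "carrier (presented_algebra R) = carrier (?F Quot relator_ideal R)"
    "monoid.mult (presented_algebra R) = monoid.mult (?F Quot relator_ideal R)"
    "one (presented_algebra R) = one (?F Quot relator_ideal R)"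
    "add (presented_algebra R) = add (?F Quot relator_ideal R)"
    by (simp_all add: presented_algebra_def quotient_algebra_def ring.defs module.defs)
  show "carrier (presented_algebra R) = range (coset R)"
    unfolding sel by (auto simp: FactRing_def A_RCOSETS_def' free_algebra_simps)
  show "coset R x \<otimes>\<^bsub>presented_algebra R\<^esub> coset R y = coset R (x * y)"
    unfolding sel using ring_hom_mult[OF rcos_ring_hom, of x y] by (simp add: free_algebra_simps)
  show "coset R x \<oplus>\<^bsub>presented_algebra R\<^esub> coset R y = coset R (x + y)"
    unfolding sel using ring_hom_add[OF rcos_ring_hom, of x y] by (simp add: free_algebra_simps)
  show "\<one>\<^bsub>presented_algebra R\<^esub> = coset R 1"
    unfolding sel using ring_hom_one[OF rcos_ring_hom] by (simp add: free_algebra_simps)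
qed

text \<open>The preimage \<open>?J\<close> of an ideal under a homomorphism is an ideal; as it
  contains \<open>R\<close>, it contains the ideal generated by \<open>R\<close>.\<close>

lemma subst_relator_ideal:
  assumes "\<And>r. r \<in> R \<Longrightarrow> subst f r \<in> relator_ideal S" and "x \<in> relator_ideal R"
  shows "subst f x \<in> relator_ideal S"
proof -
  let ?F = "free_algebra :: (complex, 'a free) module"
  let ?J = "{x. subst f x \<in> relator_ideal S}"
  interpret ring ?F by (rule ring_free_algebra)
  have inv: "\<ominus>\<^bsub>?F\<^esub> y = - y" for y
    by (rule minus_equality) (simp_all add: free_algebra_simps)
  have "ideal ?J ?F"
  proof (rule idealI[OF ring_free_algebra])
    show "subgroup ?J (add_monoid ?F)"
      by (rule add.subgroupI)
        (auto simp: inv inv[unfolded a_inv_def] free_algebra_simps subst_simps relator_ideal_intros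
          intro!: exI[of _ 0])
  qed (simp_all add: free_algebra_simps subst_simps relator_ideal_intros)
  then have "relator_ideal R \<subseteq> ?J"
    by (rule genideal_minimal) (use assms(1) in auto)
  then show ?thesis using assms(2) by auto
qed

lemma subst_subst_cong_id:
  assumes "\<And>g. subst k (f g) - gen g \<in> relator_ideal R"
  shows "subst k (subst f x) - x \<in> relator_ideal R"
proof (induction x rule: free_induct)
  case (add x y)
  have "subst k (subst f (x + y)) - (x + y)
      = (subst k (subst f x) - x) + (subst k (subst f y) - y)"
    by (simp add: subst_simps)
  then show ?case
    using add by (simp only: relator_ideal_add)
next
  case (mult x y)
  \<comment> \<open>Telescoping through \<open>x * subst k (subst f y)\<close> leaves one factor in
    the ideal in each summand.\<close>
  have "subst k (subst f (x * y)) - x * y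
      = (subst k (subst f x) - x) * subst k (subst f y) + x * (subst k (subst f y) - y)"
    by (simp add: subst_simps algebra_simps)
  then show ?case
    using mult by (simp add: relator_ideal_intros)
qed (simp_all add: subst_simps relator_ideal_zero assms)

text \<open>Assignments in both directions that respect the relators descend to the quotients. They
  are mutually inverse there as soon as both composites fix the generators modulo the
  relators.\<close>

lemma presented_algebra_iso:
  assumes f: "\<And>r. r \<in> R \<Longrightarrow> subst f r \<in> relator_ideal S"
    and k: "\<And>s. s \<in> S \<Longrightarrow> subst k s \<in> relator_ideal R"
    and kf: "\<And>g. subst k (f g) - gen g \<in> relator_ideal R"
    and fk: "\<And>g. subst f (k g) - gen g \<in> relator_ideal S"
  shows "\<exists>h \<in> ring_iso (presented_algebra R) (presented_algebra S).
    \<forall>c. \<forall>x \<in> carrier (presented_algebra R).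
      h (c \<odot>\<^bsub>presented_algebra R\<^esub> x) = c \<odot>\<^bsub>presented_algebra S\<^esub> h x"
proof -
  have ex: "\<exists>h. \<forall>x. h (coset R x) = coset S (subst f x)"
    if "\<And>r. r \<in> R \<Longrightarrow> subst f r \<in> relator_ideal S"
    for f :: "'x \<Rightarrow> 'y free" and R S
  proof -
    \<comment> \<open>\<open>inv_into\<close> selects some representative of the coset; by
      \<open>subst_relator_ideal\<close> the choice does not affect the image coset.\<close>
    have "coset S (subst f (inv_into UNIV (coset R) (coset R x))) = coset S (subst f x)" for x
    proof -
      have "coset R (inv_into UNIV (coset R) (coset R x)) = coset R x"
        by (rule f_inv_into_f) simp
      then show ?thesis
        using subst_relator_ideal[OF that] by (simp add: coset_eq_iff flip: subst_diff)
    qed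
    then show ?thesis by (intro exI[of _ "\<lambda>X. coset S (subst f (inv_into UNIV (coset R) X))"]) simp
  qed
  obtain h where h: "\<And>x. h (coset R x) = coset S (subst f x)"
    using ex[of R f S] f by blast
  obtain h' where h': "\<And>x. h' (coset S x) = coset R (subst k x)"
    using ex[of S k R] k by blast
  have "bij_betw h (range (coset R)) (range (coset S))"
    by (rule bij_betw_byWitness[where f' = h'])
      (auto simp: h h' coset_eq_iff subst_subst_cong_id kf fk)
  then have "h \<in> ring_iso (presented_algebra R) (presented_algebra S)"
    unfolding ring_iso_def
    by (auto intro!: ring_hom_memI simp: presented_algebra_simps h subst_simps)
  moreover have "h (c \<odot>\<^bsub>presented_algebra R\<^esub> x) = c \<odot>\<^bsub>presented_algebra S\<^esub> h x"
    if "x \<in> carrier (presented_algebra R)" for c x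
    using that by (auto simp: presented_algebra_simps smult_presented_coset h subst_simps)
  ultimately show ?thesis by blast
qed

section \<open>Centrality modulo the relators\<close>

definition central_mod :: "'g free set \<Rightarrow> 'g free \<Rightarrow> bool" where
  "central_mod R z \<longleftrightarrow> (\<forall>x. z * x - x * z \<in> relator_ideal R)"

lemma central_mod_relators: "central_relators z \<subseteq> R \<Longrightarrow> central_mod R z"
  by (auto simp: central_mod_def central_relators_def intro!: relator_ideal_incl)

text \<open>Commutation with \<open>z\<close> is a derivation modulo the ideal, so it vanishes
  everywhere once it vanishes on generators.\<close>

lemma central_modI:
  assumes "\<And>g. z * gen g - gen g * z \<in> relator_ideal R"
  shows "central_mod R z"
  unfolding central_mod_def
proof
  fix x
  show "z * x - x * z \<in> relator_ideal R"
  proof (induction x rule: free_induct)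
    case (scalar c)
    show ?case by (simp add: scalar_commute relator_ideal_zero)
  next
    case (add x y)
    have "z * (x + y) - (x + y) * z = (z * x - x * z) + (z * y - y * z)"
      by (simp add: algebra_simps)
    then show ?case using add by (simp add: relator_ideal_add)
  next
    case (mult x y)
    have "z * (x * y) - x * y * z = (z * x - x * z) * y + x * (z * y - y * z)"
      by (simp add: algebra_simps)
    then show ?case using mult by (simp add: relator_ideal_intros)
  qed (rule assms)
qed

lemma central_mod_scalar: "central_mod R (scalar c)"
  by (simp add: central_mod_def scalar_commute relator_ideal_zero)

lemma central_mod_add: "central_mod R y \<Longrightarrow> central_mod R z \<Longrightarrow> central_mod R (y + z)"
  unfolding central_mod_def
proof
  fix x assume *: "\<forall>x. y * x - x * y \<in> relator_ideal R" "\<forall>x. z * x - x * z \<in> relator_ideal R"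
  have "(y + z) * x - x * (y + z) = (y * x - x * y) + (z * x - x * z)"
    by (simp add: algebra_simps)
  then show "(y + z) * x - x * (y + z) \<in> relator_ideal R"
    using * by (simp add: relator_ideal_add)
qed

lemma central_mod_scalar_mult: "central_mod R z \<Longrightarrow> central_mod R (scalar c * z)"
  unfolding central_mod_def
proof
  fix x assume *: "\<forall>x. z * x - x * z \<in> relator_ideal R"
  have "scalar c * z * x - x * (scalar c * z) = scalar c * (z * x - x * z)"
    by (simp add: algebra_simps) (metis mult.assoc scalar_commute)
  then show "scalar c * z * x - x * (scalar c * z) \<in> relator_ideal R"
    using * by (simp add: relator_ideal_mult_left)
qed

lemma central_mod_uminus: "central_mod R z \<Longrightarrow> central_mod R (- z)"
  using central_mod_scalar_mult[of R z "- 1"] by (simp add: scalar_simps)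

lemma central_mod_diff: "central_mod R y \<Longrightarrow> central_mod R z \<Longrightarrow> central_mod R (y - z)"
  using central_mod_add[of R y "- z"] by (simp add: central_mod_uminus)

lemma central_mod_cong:
  assumes "y - z \<in> relator_ideal R" "central_mod R z"
  shows "central_mod R y"
proof -
  have "central_mod R (y - z)"
    using assms(1) by (simp add: central_mod_def relator_ideal_intros)
  then show ?thesis
    using central_mod_add[of R "y - z" z] assms(2) by simp
qed

text \<open>Handles an infinite family of centrality relators by a single centrality statement about
  the image.\<close>

lemma central_mod_subst_relators:
  "central_mod S (subst f z) \<Longrightarrow> r \<in> central_relators z \<Longrightarrow> subst f r \<in> relator_ideal S"
  by (auto simp: central_relators_def central_mod_def subst_simps)


section \<open>The isomorphism\<close>

lemma scalar_4_mult: "scalar 4 * x = x + x + x + x"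
proof -
  have "scalar 4 * x = (scalar 1 + scalar 1 + scalar 1 + scalar 1) * x"
    by (simp flip: scalar_simps(3))
  then show ?thesis
    by (simp only: distrib_right scalar_simps(2) mult_1)
qed

lemma scalar_half_double: "scalar (1/2) + scalar (1/2) = 1"
  by (simp add: scalar_simps(2) flip: scalar_simps(3))

lemma scalar_mult_power2: "(scalar c * x)\<^sup>2 = scalar (c\<^sup>2) * (x * x)"
  by (simp add: power2_eq_square scalar_simps(4) mult.assoc) (metis mult.assoc scalar_commute)

text \<open>Under \<open>a + b + c + d = - 1/2\<close> this is \<open>c + d - a - b\<close>.\<close>

definition bi_image :: "'g free \<Rightarrow> 'g free \<Rightarrow> 'g free" where
  "bi_image a b = - (a + a + b + b + scalar (1/2))"

text \<open>The central term in the anticommutator of \<open>bi_image a b\<close> and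
  \<open>bi_image b c\<close>: the squares of the pair \<open>c, a\<close> belonging to the third
  image enter negatively, those of the complementary pair \<open>b, d\<close> positively.\<close>

definition omega_image :: "'g free \<Rightarrow> 'g free \<Rightarrow> 'g free \<Rightarrow> 'g free \<Rightarrow> 'g free" where
  "omega_image a b c d = scalar 4 * (b\<^sup>2 + d\<^sup>2 - a\<^sup>2 - c\<^sup>2)"

definition bi_to_ddaha :: "bi_gen \<Rightarrow> ddaha_gen free" where
  "bi_to_ddaha g = (let a = gen T0; b = gen T1; c = gen U0; d = gen U1 in
    case g of
      K1 \<Rightarrow> bi_image a b | K2 \<Rightarrow> bi_image b c | K3 \<Rightarrow> bi_image c a
    | \<omega>1 \<Rightarrow> omega_image b c a d | \<omega>2 \<Rightarrow> omega_image c a b d | \<omega>3 \<Rightarrow> omega_image a b c d)"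

text \<open>The three images \<open>bi_image\<close> of the pairs from \<open>a, b, c\<close> sum to
  \<open>-4(a + b + c) - 3/2\<close>, that is \<open>4 d + 1/2\<close>; solving for \<open>d\<close>
  gives this formula.\<close>

definition ddaha_image :: "'g free \<Rightarrow> 'g free \<Rightarrow> 'g free \<Rightarrow> 'g free" where
  "ddaha_image x y z = scalar (1/4) * (x + y + z - scalar (1/2))"

text \<open>For each of \<open>T0\<close>, \<open>T1\<close>, \<open>U0\<close>, the signs change at
  the two \<open>K\<close>'s whose images under \<open>bi_to_ddaha\<close> involve that
  generator.\<close>

definition ddaha_to_bi :: "ddaha_gen \<Rightarrow> bi_gen free" where
  "ddaha_to_bi g = (let x = gen K1; y = gen K2; z = gen K3 in
    case g of
      T0 \<Rightarrow> ddaha_image (- x) y (- z) | T1 \<Rightarrow> ddaha_image (- x) (- y) z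
    | U0 \<Rightarrow> ddaha_image x (- y) (- z) | U1 \<Rightarrow> ddaha_image x y z)"

text \<open>Constants and linear terms are made homogeneous of degree two by means of
  \<open>1 = scalar (1/2) + scalar (1/2)\<close>, so that the identities below are
  identities of polynomials with integer coefficients and a central variable \<open>h\<close>.\<close>

lemma bi_image_anticomm:
  assumes "a + b + c + d + scalar (1/2) \<in> relator_ideal S"
  shows "anticomm (bi_image a b) (bi_image b c) - (bi_image c a + omega_image a b c d)
    \<in> relator_ideal S"
proof -
  define h :: "'a free" where "h = scalar (1/2)"
  define s where "s = a + b + c + d + h"
  have comm: "a * h = h * a" "b * h = h * b" "c * h = h * c" "s * h = h * s"
    unfolding h_def by (rule scalar_commute)+
  then have lcomm: "a * (h * w) = h * (a * w)" "b * (h * w) = h * (b * w)"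
    "c * (h * w) = h * (c * w)" "s * (h * w) = h * (s * w)" for w
    by (metis mult.assoc)+
  have d: "d = s - a - b - c - h" by (simp add: s_def)
  \<comment> \<open>Since \<open>d = s - (a + b + c + h)\<close>, this \<open>p\<close> equals
    \<open>d\<^sup>2 - (a + b + c + h)\<^sup>2\<close>, written so that each term contains the
    factor \<open>s\<close> from the ideal.\<close>
  define p where "p = s * d - (a + b + c + h) * s"
  have "s \<in> relator_ideal S" using assms by (simp add: s_def h_def)
  then have "- (scalar 4 * p) \<in> relator_ideal S"
    by (simp add: p_def relator_ideal_intros)
  moreover have lin: "bi_image c a = - ((h + h) * (c + c + a + a + h))"
    by (simp add: bi_image_def h_def scalar_half_double)
  have "anticomm (bi_image a b) (bi_image b c) - (bi_image c a + omega_image a b c d)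
      = - (scalar 4 * p)"
    unfolding lin
    by (simp add: anticomm_def omega_image_def bi_image_def scalar_4_mult power2_eq_square
      p_def d algebra_simps comm lcomm flip: h_def)
  ultimately show ?thesis by simp
qed

text \<open>In the signed sum of the four squares the sign patterns cancel everything except
  \<open>anticomm x y\<close> and the mixed term of \<open>z\<close> with the constant. The result
  is \<open>anticomm x y - z\<close>, which is \<open>w\<close> modulo the relation.\<close>

lemma omega_image_ddaha_image:
  assumes "anticomm x y - (z + w) \<in> relator_ideal R"
  shows "omega_image (ddaha_image (- x) y (- z)) (ddaha_image (- x) (- y) z)
      (ddaha_image x (- y) (- z)) (ddaha_image x y z) - w \<in> relator_ideal R"
proof -
  define h :: "'a free" where "h = scalar (1/2)"
  have comm: "x * h = h * x" "y * h = h * y" "z * h = h * z"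
    unfolding h_def by (rule scalar_commute)+
  then have lcomm: "x * (h * w) = h * (x * w)" "y * (h * w) = h * (y * w)"
    "z * (h * w) = h * (z * w)" for w
    by (metis mult.assoc)+
  define A B C D where "A = - x + y - z - h" and "B = - x - y + z - h"
    and "C = x - y - z - h" and "D = x + y + z - h"
  \<comment> \<open>One factor \<open>1/4\<close> will cancel the 4 of \<open>omega_image\<close>,
    the other the 4 produced by the sum of the four squares.\<close>
  have sq: "(scalar (1/4) * v)\<^sup>2 = scalar (1/4) * (scalar (1/4) * (v * v))" for v :: "'a free"
    by (simp only: scalar_mult_power2 power2_eq_square[of "1/4"] scalar_simps(4) mult.assoc)
  have four: "scalar 4 * (scalar (1/4) * v) = v" for v :: "'a free"
    by (simp add: scalar_simps(2) flip: mult.assoc scalar_simps(4))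
  have fourth: "scalar (1/4) * (scalar 4 * v) = v" for v :: "'a free"
    by (simp add: scalar_simps(2) flip: mult.assoc scalar_simps(4))
  have z: "z = (h + h) * z" by (simp add: h_def scalar_half_double)
  have zz: "z = h * z + h * z" using z by (simp add: algebra_simps)
  have "B * B + D * D - A * A - C * C = scalar 4 * (anticomm x y - (h * z + h * z))"
    by (simp add: A_def B_def C_def D_def anticomm_def scalar_4_mult algebra_simps comm lcomm)
  also have "\<dots> = scalar 4 * (anticomm x y - z)"
    using zz by simp
  finally have sum: "B * B + D * D - A * A - C * C = scalar 4 * (anticomm x y - z)" .
  have "omega_image (ddaha_image (- x) y (- z)) (ddaha_image (- x) (- y) z)
      (ddaha_image x (- y) (- z)) (ddaha_image x y z)
    = scalar 4 * (scalar (1/4) * (scalar (1/4) * (B * B + D * D - A * A - C * C)))"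
    unfolding omega_image_def ddaha_image_def sq
    by (simp add: A_def B_def C_def D_def h_def distrib_left right_diff_distrib)
  also have "\<dots> = anticomm x y - z"
    by (simp only: sum four fourth)
  finally show ?thesis using assms by (simp add: diff_diff_eq)
qed

text \<open>The commutator of \<open>y * y\<close> with \<open>x\<close> equals that of
  \<open>y\<close> with \<open>anticomm x y\<close>, hence that of \<open>y\<close> with
  \<open>z\<close> modulo the relation and central terms. Likewise \<open>z * z\<close> contributes
  the commutator of \<open>z\<close> with \<open>y\<close>, and the two cancel.\<close>

lemma casimir_commutes:
  assumes xy: "anticomm x y - (z + w) \<in> relator_ideal R" and w: "central_mod R w"
    and zx: "anticomm z x - (y + v) \<in> relator_ideal R" and v: "central_mod R v"
  shows "(x * x + y * y + z * z) * x - x * (x * x + y * y + z * z) \<in> relator_ideal R"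
proof -
  define r s where "r = anticomm x y - (z + w)" and "s = anticomm z x - (y + v)"
  have "(x * x + y * y + z * z) * x - x * (x * x + y * y + z * z)
      = (y * r - r * y) - (w * y - y * w) + (z * s - s * z) - (v * z - z * v)"
    by (simp add: r_def s_def anticomm_def algebra_simps)
  moreover have "r \<in> relator_ideal R" "s \<in> relator_ideal R"
    using xy zx by (simp_all add: r_def s_def)
  ultimately show ?thesis
    using v w by (simp only: central_mod_def relator_ideal_intros)
qed

text \<open>Squaring \<open>x + y + z - h\<close> yields the Casimir element, the three
  anticommutators, a constant and \<open>- 2 h (x + y + z)\<close>. Because \<open>2 h = 1\<close>,
  the last term removes exactly the linear part of the anticommutators: this is why the shift is
  1/2.\<close>

lemma central_mod_ddaha_image_power2:
  assumes "anticomm x y - (z + w) \<in> relator_ideal R" "central_mod R w"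
    and "anticomm y z - (x + u) \<in> relator_ideal R" "central_mod R u"
    and "anticomm z x - (y + v) \<in> relator_ideal R" "central_mod R v"
    and "central_mod R (x * x + y * y + z * z)"
  shows "central_mod R ((ddaha_image x y z)\<^sup>2)"
proof -
  define h :: "'a free" where "h = scalar (1/2)"
  have comm: "x * h = h * x" "y * h = h * y" "z * h = h * z"
    unfolding h_def by (rule scalar_commute)+
  define r s t where "r = anticomm x y - (z + w)" and "s = anticomm y z - (x + u)"
    and "t = anticomm z x - (y + v)"
  let ?l = "x + y + z - h"
  let ?q = "x * x + y * y + z * z + u + v + w + h * h"
  have "(h + h) * (x + y + z) = x + y + z"
    by (simp add: h_def scalar_half_double)
  then have lin: "h * x + h * x + (h * y + h * y) + (h * z + h * z) = x + y + z"
    by (simp add: algebra_simps)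
  have "?l * ?l - ?q = r + s + t + (x + y + z)
      - (h * x + h * x + (h * y + h * y) + (h * z + h * z))"
    by (simp add: r_def s_def t_def anticomm_def algebra_simps comm)
  then have "?l * ?l - ?q = r + s + t"
    unfolding lin by simp
  then have "?l * ?l - ?q \<in> relator_ideal R"
    using assms by (simp only: r_def s_def t_def relator_ideal_intros)
  moreover have "central_mod R ?q"
    using assms by (simp add: central_mod_add central_mod_scalar h_def flip: scalar_simps(4))
  ultimately have "central_mod R (?l * ?l)" by (rule central_mod_cong)
  then show ?thesis
    by (simp add: ddaha_image_def scalar_mult_power2 central_mod_scalar_mult h_def)
qed

section \<open>Relators are sent into the relator ideals\<close>

lemma bi_to_ddaha_relators:
  assumes "r \<in> bi_relators"
  shows "subst bi_to_ddaha r \<in> relator_ideal ddaha_relators"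
proof -
  let ?I = "relator_ideal ddaha_relators" and ?C = "central_mod ddaha_relators"
  have sum: "gen T0 + gen T1 + gen U0 + gen U1 + scalar (1/2) \<in> ?I"
    using relator_ideal_incl[of "gen T0 + gen T1 + gen U0 + gen U1 - scalar (- 1 / 2)"
        ddaha_relators]
    by (simp add: ddaha_relators_def scalar_simps(5))
  have "?C ((gen g)\<^sup>2)" for g
    by (cases g; hypsubst; rule central_mod_relators) (auto simp: ddaha_relators_def)
  then have omega: "?C (omega_image (gen a) (gen b) (gen c) (gen d))" for a b c d
    by (simp add: omega_image_def central_mod_scalar_mult central_mod_add central_mod_diff)
  \<comment> \<open>The three relations arise from one another by rotating \<open>T0\<close>,
    \<open>T1\<close>, \<open>U0\<close> with \<open>U1\<close> fixed.\<close>
  have "anticomm (bi_image (gen T0) (gen T1)) (bi_image (gen T1) (gen U0))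
      - (bi_image (gen U0) (gen T0) + omega_image (gen T0) (gen T1) (gen U0) (gen U1)) \<in> ?I"
    "anticomm (bi_image (gen T1) (gen U0)) (bi_image (gen U0) (gen T0))
      - (bi_image (gen T0) (gen T1) + omega_image (gen T1) (gen U0) (gen T0) (gen U1)) \<in> ?I"
    "anticomm (bi_image (gen U0) (gen T0)) (bi_image (gen T0) (gen T1))
      - (bi_image (gen T1) (gen U0) + omega_image (gen U0) (gen T0) (gen T1) (gen U1)) \<in> ?I"
    by (rule bi_image_anticomm; use sum in \<open>simp add: add_ac\<close>)+
  moreover have "subst bi_to_ddaha (anticomm x y)
      = anticomm (subst bi_to_ddaha x) (subst bi_to_ddaha y)" for x y
    by (simp add: anticomm_def subst_simps)
  ultimately show ?thesis
    using assms unfolding bi_relators_def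
    by (auto simp: subst_simps bi_to_ddaha_def omega
        intro: central_mod_subst_relators[rotated])
qed

lemma bi_relators_mem:
  "anticomm (gen K1) (gen K2) - (gen K3 + gen \<omega>3) \<in> relator_ideal bi_relators"
  "anticomm (gen K2) (gen K3) - (gen K1 + gen \<omega>1) \<in> relator_ideal bi_relators"
  "anticomm (gen K3) (gen K1) - (gen K2 + gen \<omega>2) \<in> relator_ideal bi_relators"
  by (rule relator_ideal_incl; simp add: bi_relators_def)+

lemma bi_omega_central:
  "central_mod bi_relators (gen \<omega>1)" "central_mod bi_relators (gen \<omega>2)"
  "central_mod bi_relators (gen \<omega>3)"
  by (rule central_mod_relators; auto simp: bi_relators_def)+

lemma bi_casimir_central:
  "central_mod bi_relators (gen K1 * gen K1 + gen K2 * gen K2 + gen K3 * gen K3)"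
    (is "central_mod _ ?Q")
proof (rule central_modI)
  fix g
  have omega: "?Q * z - z * ?Q \<in> relator_ideal bi_relators" if "central_mod bi_relators z" for z
    using that relator_ideal_uminus[of "z * ?Q - ?Q * z" bi_relators]
    by (simp add: central_mod_def)
  show "?Q * gen g - gen g * ?Q \<in> relator_ideal bi_relators"
    using casimir_commutes[OF bi_relators_mem(1) bi_omega_central(3)
        bi_relators_mem(3) bi_omega_central(2)]
      casimir_commutes[OF bi_relators_mem(2) bi_omega_central(1)
        bi_relators_mem(1) bi_omega_central(3)]
      casimir_commutes[OF bi_relators_mem(3) bi_omega_central(2)
        bi_relators_mem(2) bi_omega_central(1)]
    by (cases g) (simp_all add: omega bi_omega_central, simp_all add: add_ac)
qed

text \<open>Negating two of the \<open>K\<close>'s together with the \<omega>'s of the same indices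
  preserves the three relations and the Casimir element, so all four cases are instances of
  \<open>central_mod_ddaha_image_power2\<close>.\<close>

lemma ddaha_to_bi_power2_central: "central_mod bi_relators ((ddaha_to_bi g)\<^sup>2)"
proof -
  have neg: "anticomm (- x) (- y) = anticomm x y" "anticomm (- x) y = - anticomm x y"
    "anticomm x (- y) = - anticomm x y" for x y :: "bi_gen free"
    by (simp_all add: anticomm_def)
  have flip: "- r - (- x + - y) \<in> relator_ideal R" if "r - (x + y) \<in> relator_ideal R"
    for r x y :: "bi_gen free" and R
    using relator_ideal_uminus[OF that] by (simp add: algebra_simps)
  note mem = bi_relators_mem bi_relators_mem[THEN flip]
  note cent = bi_omega_central bi_omega_central[THEN central_mod_uminus]
  show ?thesis
  proof (cases g)
    case T0
    show ?thesis unfolding T0 ddaha_to_bi_def Let_def ddaha_gen.case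
      by (rule central_mod_ddaha_image_power2[where w = "- gen \<omega>3" and u = "- gen \<omega>1" and v = "gen \<omega>2"];
        simp only: neg minus_minus minus_mult_minus mem cent bi_casimir_central)
  next
    case T1
    show ?thesis unfolding T1 ddaha_to_bi_def Let_def ddaha_gen.case
      by (rule central_mod_ddaha_image_power2[where w = "gen \<omega>3" and u = "- gen \<omega>1" and v = "- gen \<omega>2"];
        simp only: neg minus_minus minus_mult_minus mem cent bi_casimir_central)
  next
    case U0
    show ?thesis unfolding U0 ddaha_to_bi_def Let_def ddaha_gen.case
      by (rule central_mod_ddaha_image_power2[where w = "- gen \<omega>3" and u = "gen \<omega>1" and v = "- gen \<omega>2"];
        simp only: neg minus_minus minus_mult_minus mem cent bi_casimir_central)
  next
    case U1
    show ?thesis unfolding U1 ddaha_to_bi_def Let_def ddaha_gen.case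
      by (rule central_mod_ddaha_image_power2[where w = "gen \<omega>3" and u = "gen \<omega>1" and v = "gen \<omega>2"];
        simp only: mem cent bi_casimir_central)
  qed
qed

text \<open>Coefficients are \<open>scalar\<close> factors, so expanding linear expressions leaves
  four equal right-nested summands, which this collects.\<close>

lemma scalar_quarter_sum:
  "scalar (1/4) * x + (scalar (1/4) * x + (scalar (1/4) * x + scalar (1/4) * x)) = x"
  using scalar_4_mult[of "scalar (1/4) * x"]
  by (simp add: add.assoc scalar_simps(2) flip: mult.assoc scalar_simps(4))

text \<open>Each variable occurs twice with each sign, so only four constants \<open>- 1/8\<close>
  remain. The linear relator therefore maps to 0 already in the free algebra.\<close>

lemma ddaha_image_sum:
  "ddaha_image (- x) y (- z) + ddaha_image (- x) (- y) z + ddaha_image x (- y) (- z)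
    + ddaha_image x y z = - scalar (1/2)"
proof -
  have "ddaha_image (- x) y (- z) + ddaha_image (- x) (- y) z + ddaha_image x (- y) (- z)
      + ddaha_image x y z = - (scalar (1/4) * scalar (1/2) + (scalar (1/4) * scalar (1/2)
        + (scalar (1/4) * scalar (1/2) + scalar (1/4) * scalar (1/2))))"
    by (simp add: ddaha_image_def algebra_simps)
  then show ?thesis by (simp only: scalar_quarter_sum)
qed

lemma ddaha_to_bi_relators:
  assumes "r \<in> ddaha_relators"
  shows "subst ddaha_to_bi r \<in> relator_ideal bi_relators"
proof -
  have "subst ddaha_to_bi (gen T0 + gen T1 + gen U0 + gen U1 - scalar (- 1 / 2)) = 0"
    by (simp add: subst_simps ddaha_to_bi_def ddaha_image_sum scalar_simps(5))
  moreover have "central_mod bi_relators (subst ddaha_to_bi ((gen g)\<^sup>2))" for g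
    using ddaha_to_bi_power2_central[of g] by (simp add: subst_simps power2_eq_square)
  ultimately show ?thesis
    using assms unfolding ddaha_relators_def
    by (auto simp: relator_ideal_zero intro: central_mod_subst_relators[rotated])
qed

section \<open>The two composites fix the generators\<close>

lemma subst_bi_image: "subst f (bi_image a b) = bi_image (subst f a) (subst f b)"
  by (simp add: bi_image_def subst_simps)

lemma subst_omega_image:
  "subst f (omega_image a b c d) = omega_image (subst f a) (subst f b) (subst f c) (subst f d)"
  by (simp add: omega_image_def power2_eq_square subst_simps)

lemma subst_ddaha_image:
  "subst f (ddaha_image x y z) = ddaha_image (subst f x) (subst f y) (subst f z)"
  by (simp add: ddaha_image_def subst_simps)

lemma ddaha_image_rotate:
  "ddaha_image x y z = ddaha_image y z x" "ddaha_image x y z = ddaha_image z x y"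
  by (simp_all add: ddaha_image_def add_ac)

lemma bi_image_ddaha_image:
  "bi_image (ddaha_image (- x) y (- z)) (ddaha_image (- x) (- y) z) = x"
  "bi_image (ddaha_image (- x) (- y) z) (ddaha_image x (- y) (- z)) = y"
  "bi_image (ddaha_image x (- y) (- z)) (ddaha_image (- x) y (- z)) = z"
proof -
  have "bi_image (ddaha_image (- x) y (- z)) (ddaha_image (- x) (- y) z)
      = scalar (1/4) * x + (scalar (1/4) * x + (scalar (1/4) * x + scalar (1/4) * x))
        + (scalar (1/4) * scalar (1/2) + (scalar (1/4) * scalar (1/2)
          + (scalar (1/4) * scalar (1/2) + scalar (1/4) * scalar (1/2)))) - scalar (1/2)"
    for x y z :: "'a free"
    by (simp add: bi_image_def ddaha_image_def algebra_simps)
  then have *: "bi_image (ddaha_image (- x) y (- z)) (ddaha_image (- x) (- y) z) = x"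
    for x y z :: "'a free"
    by (simp add: scalar_quarter_sum)
  show "bi_image (ddaha_image (- x) y (- z)) (ddaha_image (- x) (- y) z) = x"
    "bi_image (ddaha_image (- x) (- y) z) (ddaha_image x (- y) (- z)) = y"
    "bi_image (ddaha_image x (- y) (- z)) (ddaha_image (- x) y (- z)) = z"
    using *[of x y z] *[of y z x] *[of z x y] by (simp_all add: ddaha_image_rotate)
qed

text \<open>The \<open>K\<close>'s return exactly; each \<omega> returns only modulo the
  anticommutator relation that expresses it through the \<open>K\<close>'s.\<close>

lemma bi_round_trip:
  "subst ddaha_to_bi (bi_to_ddaha g) - gen g \<in> relator_ideal bi_relators"
proof (cases g)
  case \<omega>1
  then show ?thesis
    using omega_image_ddaha_image[OF bi_relators_mem(2)]
    by (simp add: bi_to_ddaha_def ddaha_to_bi_def subst_omega_image subst_gen ddaha_image_rotate)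
next
  case \<omega>2
  then show ?thesis
    using omega_image_ddaha_image[OF bi_relators_mem(3)]
    by (simp add: bi_to_ddaha_def ddaha_to_bi_def subst_omega_image subst_gen ddaha_image_rotate)
next
  case \<omega>3
  then show ?thesis
    using omega_image_ddaha_image[OF bi_relators_mem(1)]
    by (simp add: bi_to_ddaha_def ddaha_to_bi_def subst_omega_image subst_gen)
qed (simp_all add: bi_to_ddaha_def ddaha_to_bi_def subst_bi_image subst_gen
      bi_image_ddaha_image relator_ideal_zero)

text \<open>The contributions of \<open>b\<close> and \<open>c\<close> cancel, as do the shifts,
  leaving a quarter of \<open>4 a\<close>.\<close>

lemma ddaha_image_bi_image:
  "ddaha_image (- bi_image a b) (bi_image b c) (- bi_image c a) = a"
proof -
  have "ddaha_image (- bi_image a b) (bi_image b c) (- bi_image c a)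
      = scalar (1/4) * a + (scalar (1/4) * a + (scalar (1/4) * a + scalar (1/4) * a))"
    by (simp add: bi_image_def ddaha_image_def algebra_simps)
  then show ?thesis by (simp only: scalar_quarter_sum)
qed

lemma ddaha_image_bi_image_all:
  "ddaha_image (bi_image a b) (bi_image b c) (bi_image c a) = - (a + b + c + scalar (1/2))"
proof -
  let ?h = "scalar (1/2) :: 'a free"
  have "ddaha_image (bi_image a b) (bi_image b c) (bi_image c a)
      = - (scalar (1/4) * a + (scalar (1/4) * a + (scalar (1/4) * a + scalar (1/4) * a)))
        - (scalar (1/4) * b + (scalar (1/4) * b + (scalar (1/4) * b + scalar (1/4) * b)))
        - (scalar (1/4) * c + (scalar (1/4) * c + (scalar (1/4) * c + scalar (1/4) * c)))
        - (scalar (1/4) * ?h + (scalar (1/4) * ?h + (scalar (1/4) * ?h + scalar (1/4) * ?h)))"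
    by (simp add: bi_image_def ddaha_image_def algebra_simps)
  then show ?thesis by (simp add: scalar_quarter_sum)
qed

lemma ddaha_round_trip:
  "subst bi_to_ddaha (ddaha_to_bi g) - gen g \<in> relator_ideal ddaha_relators"
proof (cases g)
  case T0
  then show ?thesis
    by (simp add: bi_to_ddaha_def ddaha_to_bi_def subst_ddaha_image subst_simps
        ddaha_image_bi_image relator_ideal_zero)
next
  case T1
  then show ?thesis
    using ddaha_image_bi_image[of "gen T1" "gen U0" "gen T0"]
    by (simp add: bi_to_ddaha_def ddaha_to_bi_def subst_ddaha_image subst_simps
        ddaha_image_rotate relator_ideal_zero)
next
  case U0
  then show ?thesis
    using ddaha_image_bi_image[of "gen U0" "gen T0" "gen T1"]
    by (simp add: bi_to_ddaha_def ddaha_to_bi_def subst_ddaha_image subst_simps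
        ddaha_image_rotate relator_ideal_zero)
next
  case U1
  \<comment> \<open>The images of the \<open>K\<close>'s involve only \<open>T0\<close>,
    \<open>T1\<close>, \<open>U0\<close>, so recovering \<open>U1\<close> takes the linear relation,
    while the other three return exactly.\<close>
  have "gen T0 + gen T1 + gen U0 + gen U1 - scalar (- 1 / 2) \<in> relator_ideal ddaha_relators"
    by (rule relator_ideal_incl) (simp add: ddaha_relators_def)
  from relator_ideal_uminus[OF this] show ?thesis
    by (simp add: U1 bi_to_ddaha_def ddaha_to_bi_def subst_ddaha_image subst_simps
        ddaha_image_bi_image_all scalar_simps(5) algebra_simps)
qed

theorem proposition2:
  shows "\<exists>h \<in> ring_iso bannai_ito_algebra universal_ddaha.
    \<forall>c. \<forall>x \<in> carrier bannai_ito_algebra.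
      h (c \<odot>\<^bsub>bannai_ito_algebra\<^esub> x) = c \<odot>\<^bsub>universal_ddaha\<^esub> h x"
  unfolding bannai_ito_algebra_def universal_ddaha_def
  by (rule presented_algebra_iso)
    (fact bi_to_ddaha_relators ddaha_to_bi_relators bi_round_trip ddaha_round_trip)+

end
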